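(* Let $\mathfrak g$ be the eight-dimensional real Lie algebra with basis $\xi,X,Y,Z,X',Y',Z',H$ whose non-zero brackets of basis vectors (up to skew-symmetry) are $$[X,Y]=Z,\quad [X',Y']=Z',\quad [Y,Z]=H,\quad [Y',Z']=H,\quad [\xi,Y]=X,\quad [\xi,Y']=X',$$ and let $$\omega=\xi^*\wedge H^*+X^*\wedge Z^*+X'^*\wedge Z'^*+Y^*\wedge Y'^* ,$$ where $\xi^*,X^*,\dots,H^*$ is the dual basis; $(\mathfrak g,\omega)$ is a symplectic Lie algebra. Then $\mathfrak g$ is four-step nilpotent and $(\mathfrak g,\omega)$ has symplectic rank three. In particular, $(\mathfrak g,\omega)$ has no Lagrangian ideal.
   Context: A symplectic Lie algebra $(\mathfrak g,\omega)$ is a Lie algebra with a non-degenerate alternating form $\omega$ satisfying $\omega([u,v],w)+\omega([w,u],v)+\omega([v,w],u)=0$. A subspace is isotropic if $\omega$ vanishes on it, and Lagrangian if it is isotropic of dimension $\frac12\dim\mathfrak g$. An isotropic (Lagrangian) ideal is an ideal that is an isotropic (Lagrangian) subspace. The symplectic rank of $(\mathfrak g,\omega)$ is the maximal dimension of an isotropic ideal. With $C^0\mathfrak g=\mathfrak g$, $C^{i+1}\mathfrak g=[\mathfrak g,C^i\mathfrak g]$, four-step nilpotent here means $C^4\mathfrak g=0$ and $C^3\mathfrak g\neq0$. *)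

theory Defs
  imports "HOL-Analysis.Analysis"
begin

(* Finite-dimensional real Lie algebras, with the whole type as underlying space.
   Class euclidean_space serves only as "finite-dimensional real vector space";
   the inner product is never used. *)

definition lie_algebra :: "('a::euclidean_space \<Rightarrow> 'a \<Rightarrow> 'a) \<Rightarrow> bool" where
  "lie_algebra br \<longleftrightarrow> bilinear br \<and> (\<forall>u. br u u = 0) \<and>
     (\<forall>u v w. br u (br v w) + br v (br w u) + br w (br u v) = 0)"

definition symplectic_lie_algebra ::
  "('a::euclidean_space \<Rightarrow> 'a \<Rightarrow> 'a) \<Rightarrow> ('a \<Rightarrow> 'a \<Rightarrow> real) \<Rightarrow> bool" where
  "symplectic_lie_algebra br \<omega> \<longleftrightarrow> lie_algebra br \<and>
     bilinear \<omega> \<and> (\<forall>u. \<omega> u u = 0) \<and> (\<forall>u. (\<forall>v. \<omega> u v = 0) \<longrightarrow> u = 0) \<and>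
     (\<forall>u v w. \<omega> (br u v) w + \<omega> (br w u) v + \<omega> (br v w) u = 0)"

definition lie_ideal :: "('a::euclidean_space \<Rightarrow> 'a \<Rightarrow> 'a) \<Rightarrow> 'a set \<Rightarrow> bool" where
  "lie_ideal br I \<longleftrightarrow> subspace I \<and> (\<forall>u. \<forall>v\<in>I. br u v \<in> I)"

definition isotropic :: "('a::euclidean_space \<Rightarrow> 'a \<Rightarrow> real) \<Rightarrow> 'a set \<Rightarrow> bool" where
  "isotropic \<omega> S \<longleftrightarrow> subspace S \<and> (\<forall>u\<in>S. \<forall>v\<in>S. \<omega> u v = 0)"

definition lagrangian :: "('a::euclidean_space \<Rightarrow> 'a \<Rightarrow> real) \<Rightarrow> 'a set \<Rightarrow> bool" where
  "lagrangian \<omega> S \<longleftrightarrow> isotropic \<omega> S \<and> 2 * dim S = dim (UNIV :: 'a set)"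

definition isotropic_ideal ::
  "('a::euclidean_space \<Rightarrow> 'a \<Rightarrow> 'a) \<Rightarrow> ('a \<Rightarrow> 'a \<Rightarrow> real) \<Rightarrow> 'a set \<Rightarrow> bool" where
  "isotropic_ideal br \<omega> I \<longleftrightarrow> lie_ideal br I \<and> isotropic \<omega> I"

definition lagrangian_ideal ::
  "('a::euclidean_space \<Rightarrow> 'a \<Rightarrow> 'a) \<Rightarrow> ('a \<Rightarrow> 'a \<Rightarrow> real) \<Rightarrow> 'a set \<Rightarrow> bool" where
  "lagrangian_ideal br \<omega> I \<longleftrightarrow> lie_ideal br I \<and> lagrangian \<omega> I"

(* For bilinear br, the set is non-empty (it contains 0) and bounded by dim UNIV,
   so Max is a genuine maximum. *)
definition symplectic_rank ::
  "('a::euclidean_space \<Rightarrow> 'a \<Rightarrow> 'a) \<Rightarrow> ('a \<Rightarrow> 'a \<Rightarrow> real) \<Rightarrow> nat" where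
  "symplectic_rank br \<omega> = Max {dim I | I. isotropic_ideal br \<omega> I}"

primrec lower_central_series ::
  "('a::euclidean_space \<Rightarrow> 'a \<Rightarrow> 'a) \<Rightarrow> nat \<Rightarrow> 'a set" where
  "lower_central_series br 0 = UNIV"
| "lower_central_series br (Suc i) =
     span {br u v | u v. v \<in> lower_central_series br i}"

definition four_step_nilpotent :: "('a::euclidean_space \<Rightarrow> 'a \<Rightarrow> 'a) \<Rightarrow> bool" where
  "four_step_nilpotent br \<longleftrightarrow>
     lower_central_series br 4 = {0} \<and> lower_central_series br 3 \<noteq> {0}"

datatype label = L\<xi> | LX | LY | LZ | LX' | LY' | LZ' | LH

instance label :: finite
proof
  have "(UNIV :: label set) = {L\<xi>, LX, LY, LZ, LX', LY', LZ', LH}"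
    using label.exhaust by blast
  then show "finite (UNIV :: label set)" by (metis finite.emptyI finite_insert)
qed

type_synonym g8 = "real ^ label"

abbreviation (input) basis_vec :: "label \<Rightarrow> g8" where
  "basis_vec a \<equiv> axis a 1"

abbreviation (input) dual_vec :: "label \<Rightarrow> g8 \<Rightarrow> real" where
  "dual_vec a \<equiv> (\<lambda>u. u $ a)"

(* Each listed bracket in one order only; g8_bracket skew-symmetrises. *)
fun bracket_table :: "label \<Rightarrow> label \<Rightarrow> g8" where
  "bracket_table LX LY = basis_vec LZ"
| "bracket_table LX' LY' = basis_vec LZ'"
| "bracket_table LY LZ = basis_vec LH"
| "bracket_table LY' LZ' = basis_vec LH"
| "bracket_table L\<xi> LY = basis_vec LX"
| "bracket_table L\<xi> LY' = basis_vec LX'"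
| "bracket_table _ _ = 0"

definition g8_bracket :: "g8 \<Rightarrow> g8 \<Rightarrow> g8" where
  "g8_bracket u v = (\<Sum>a\<in>UNIV. \<Sum>b\<in>UNIV.
     (dual_vec a u * dual_vec b v) *\<^sub>R (bracket_table a b - bracket_table b a))"

definition wedge :: "('a \<Rightarrow> real) \<Rightarrow> ('a \<Rightarrow> real) \<Rightarrow> 'a \<Rightarrow> 'a \<Rightarrow> real" where
  "wedge \<alpha> \<beta> u v = \<alpha> u * \<beta> v - \<alpha> v * \<beta> u"

definition g8_omega :: "g8 \<Rightarrow> g8 \<Rightarrow> real" where
  "g8_omega u v =
     wedge (dual_vec L\<xi>) (dual_vec LH) u v + wedge (dual_vec LX) (dual_vec LZ) u v +
     wedge (dual_vec LX') (dual_vec LZ') u v + wedge (dual_vec LY) (dual_vec LY') u v"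

end

theory Submission
  imports Defs
begin

text \<open>
  Applying brackets with basis vectors to an element \<open>u\<close> of an isotropic ideal \<open>I\<close> produces further
  elements of \<open>I\<close>. If one of the \<open>\<xi>\<close>, \<open>Y\<close>, \<open>Y'\<close>, \<open>X\<close>, \<open>X'\<close> coordinates of \<open>u\<close> (eliminated in this
  order) were non-zero, then these elements could not all be \<open>\<omega>\<close>-orthogonal. So every isotropic ideal
  lies in the span of \<open>Z\<close>, \<open>Z'\<close>, \<open>H\<close>, which is itself an isotropic ideal.
\<close>

lemma UNIV_label: "(UNIV :: label set) = {L\<xi>, LX, LY, LZ, LX', LY', LZ', LH}"
  using label.exhaust by blast

lemma all_label: "(\<forall>a. P a) \<longleftrightarrow> P L\<xi> \<and> P LX \<and> P LY \<and> P LZ \<and> P LX' \<and> P LY' \<and> P LZ' \<and> P LH"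
  by (metis label.exhaust)

lemma g8_eq_iff: "(u :: g8) = v \<longleftrightarrow> u $ L\<xi> = v $ L\<xi> \<and> u $ LX = v $ LX \<and> u $ LY = v $ LY \<and>
    u $ LZ = v $ LZ \<and> u $ LX' = v $ LX' \<and> u $ LY' = v $ LY' \<and> u $ LZ' = v $ LZ' \<and> u $ LH = v $ LH"
  by (simp add: vec_eq_iff all_label)

text \<open>Expanding the double sum once, coordinate by coordinate, turns the later identities
  about the bracket into polynomial arithmetic.\<close>

lemma g8_bracket_nth [simp]:
  "g8_bracket u v $ L\<xi> = 0"
  "g8_bracket u v $ LX = u $ L\<xi> * v $ LY - u $ LY * v $ L\<xi>"
  "g8_bracket u v $ LY = 0"
  "g8_bracket u v $ LZ = u $ LX * v $ LY - u $ LY * v $ LX"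
  "g8_bracket u v $ LX' = u $ L\<xi> * v $ LY' - u $ LY' * v $ L\<xi>"
  "g8_bracket u v $ LY' = 0"
  "g8_bracket u v $ LZ' = u $ LX' * v $ LY' - u $ LY' * v $ LX'"
  "g8_bracket u v $ LH = u $ LY * v $ LZ - u $ LZ * v $ LY + (u $ LY' * v $ LZ' - u $ LZ' * v $ LY')"
  by (simp_all add: g8_bracket_def UNIV_label axis_def)

lemmas g8_omega_simps = g8_omega_def wedge_def

lemma lie_algebra_g8_bracket: "lie_algebra g8_bracket"
  unfolding lie_algebra_def bilinear_def linear_iff
  by (simp add: g8_eq_iff algebra_simps)

lemma g8_omega_nondegenerate:
  assumes "\<forall>v. g8_omega u v = 0"
  shows "u = 0"
proof -
  \<comment> \<open>Up to sign, pairing \<open>u\<close> with a basis vector returns the coordinate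
    of \<open>u\<close> at its \<omega>-partner.\<close>
  have "g8_omega u (axis a 1) = 0" for a
    using assms by blast
  from this[of L\<xi>] this[of LX] this[of LY] this[of LZ]
    this[of LX'] this[of LY'] this[of LZ'] this[of LH]
  show ?thesis
    by (simp add: g8_eq_iff g8_omega_simps axis_def)
qed

lemma symplectic_lie_algebra_g8: "symplectic_lie_algebra g8_bracket g8_omega"
  unfolding symplectic_lie_algebra_def
proof (intro conjI allI impI)
  show "bilinear g8_omega"
    unfolding bilinear_def linear_iff by (simp add: g8_omega_simps algebra_simps)
qed (use lie_algebra_g8_bracket g8_omega_nondegenerate in
      \<open>auto simp: g8_omega_simps algebra_simps\<close>)

lemma bracket_in_lower_central_series:
  "v \<in> lower_central_series br i \<Longrightarrow> br u v \<in> lower_central_series br (Suc i)"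
  by (auto intro!: span_base)

lemma lower_central_series_Suc_subset:
  assumes "subspace S" and "\<And>u v. v \<in> lower_central_series br i \<Longrightarrow> br u v \<in> S"
  shows "lower_central_series br (Suc i) \<subseteq> S"
  unfolding lower_central_series.simps by (rule span_minimal) (use assms in auto)

lemma four_step_nilpotent_g8: "four_step_nilpotent g8_bracket"
proof -
  let ?C = "lower_central_series g8_bracket"
  let ?V = "\<lambda>A. {u :: g8. \<forall>a\<in>A. u $ a = 0}"
  have sub: "subspace (?V A)" for A
    by (auto simp: subspace_def)
  \<comment> \<open>In terms of spans, the bounds on \<open>?C 1\<close>, \<open>?C 2\<close>,
    \<open>?C 3\<close> are \<langle>X, X', Z, Z', H\<rangle>, \<langle>Z, Z', H\<rangle> and
    \<langle>H\<rangle>; the last one is central.\<close>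
  have C1: "?C 1 \<subseteq> ?V {L\<xi>, LY, LY'}"
    unfolding One_nat_def by (rule lower_central_series_Suc_subset[OF sub]) auto
  have C2: "?C 2 \<subseteq> ?V {L\<xi>, LY, LY', LX, LX'}"
    unfolding Suc_1[symmetric]
    by (rule lower_central_series_Suc_subset[OF sub]) (use C1 in auto)
  have C3: "?C 3 \<subseteq> ?V {L\<xi>, LY, LY', LX, LX', LZ, LZ'}"
    unfolding eval_nat_numeral(3)[of "num.One"]
    by (rule lower_central_series_Suc_subset[OF sub]) (use C2 in \<open>auto simp: numeral_2_eq_2\<close>)
  have "?C (Suc 3) \<subseteq> {0}"
    by (rule lower_central_series_Suc_subset[OF subspace_single_0])
      (use C3 in \<open>auto simp: g8_eq_iff\<close>)
  moreover have "0 \<in> ?C (Suc 3)"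
    by (simp only: lower_central_series.simps span_0)
  ultimately have C4: "?C 4 = {0}"
    by (simp del: lower_central_series.simps add: eval_nat_numeral subset_antisym)
  let ?Y = "axis LY 1 :: g8"
  \<comment> \<open>Applying ad Y repeatedly gives \<xi>, -X, Z, H, so H survives in
    \<open>?C 3\<close>.\<close>
  have "g8_bracket ?Y (g8_bracket ?Y (g8_bracket ?Y (axis L\<xi> 1))) \<in> ?C 3"
    unfolding numeral_3_eq_3 by (intro bracket_in_lower_central_series) simp
  moreover have "g8_bracket ?Y (g8_bracket ?Y (g8_bracket ?Y (axis L\<xi> 1))) = axis LH 1"
    by (simp add: g8_eq_iff axis_def)
  ultimately have "?C 3 \<noteq> {0}"
    by (metis axis_eq_0_iff singletonD zero_neq_one)
  with C4 show ?thesis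
    by (simp add: four_step_nilpotent_def)
qed

text \<open>This is the span of Z, Z', H, written in the form that
  \<open>dim_substandard_cart\<close> expects.\<close>

definition g8_ZZH :: "g8 set" where
  "g8_ZZH = {u. \<forall>a. a \<notin> {LZ, LZ', LH} \<longrightarrow> u $ a = 0}"

lemma mem_g8_ZZH:
  "u \<in> g8_ZZH \<longleftrightarrow> u $ L\<xi> = 0 \<and> u $ LX = 0 \<and> u $ LY = 0 \<and> u $ LX' = 0 \<and> u $ LY' = 0"
  by (simp add: g8_ZZH_def all_label)

lemma dim_g8_ZZH: "dim g8_ZZH = 3"
  using dim_substandard_cart[where 'a = real, of "{LZ, LZ', LH}"]
  by (simp add: g8_ZZH_def dim_vec_eq)

text \<open>Brackets with Z, Z', H yield only multiples of H, and \<omega> pairs these three vectors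
  only with X, X', \<xi>.\<close>

lemma isotropic_ideal_g8_ZZH: "isotropic_ideal g8_bracket g8_omega g8_ZZH"
  by (auto simp: isotropic_ideal_def lie_ideal_def isotropic_def subspace_def mem_g8_ZZH g8_omega_simps)

lemma isotropic_ideal_subset_g8_ZZH:
  assumes "isotropic_ideal g8_bracket g8_omega I"
  shows "I \<subseteq> g8_ZZH"
proof
  fix u assume u: "u \<in> I"
  have br: "g8_bracket w v \<in> I" if "v \<in> I" for w v
    using assms that by (auto simp: isotropic_ideal_def lie_ideal_def)
  have iso: "g8_omega v w = 0" if "v \<in> I" "w \<in> I" for v w
    using assms that by (auto simp: isotropic_ideal_def isotropic_def)
  \<comment> \<open>Here (ad Y)^3 u = (\<open>u $ L\<xi>\<close>) H, whose pairing with
    \<open>u\<close> is the square of \<open>u $ L\<xi>\<close>.\<close>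
  have \<xi>: "u $ L\<xi> = 0"
    using iso[OF u br[OF br[OF br[OF u]]], of "axis LY 1" "axis LY 1" "axis LY 1"]
    by (simp add: g8_omega_simps axis_def)
  \<comment> \<open>[\<xi>, u] = y X + y' X' and [X, u] = y Z pair to y^2; replacing X by X' gives
    y'^2.\<close>
  have y: "u $ LY = 0"
    using iso[OF br[OF u] br[OF u], of "axis L\<xi> 1" "axis LX 1"]
    by (simp add: g8_omega_simps axis_def)
  have y': "u $ LY' = 0"
    using iso[OF br[OF u] br[OF u], of "axis L\<xi> 1" "axis LX' 1"]
    by (simp add: g8_omega_simps axis_def)
  \<comment> \<open>Once the \<xi> coordinate is zero, [Y, u] = -x Z + z H, and \<omega>(u, [Y, u])
    = -x^2. The primed case is the same.\<close>
  have x: "u $ LX = 0"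
    using iso[OF u br[OF u], of "axis LY 1"] \<xi>
    by (simp add: g8_omega_simps axis_def)
  have x': "u $ LX' = 0"
    using iso[OF u br[OF u], of "axis LY' 1"] \<xi>
    by (simp add: g8_omega_simps axis_def)
  show "u \<in> g8_ZZH"
    using \<xi> x y x' y' by (simp add: mem_g8_ZZH)
qed

lemma isotropic_ideal_dim_le:
  "isotropic_ideal g8_bracket g8_omega I \<Longrightarrow> dim I \<le> 3"
  using dim_subset[OF isotropic_ideal_subset_g8_ZZH] by (simp add: dim_g8_ZZH)

lemma symplectic_rank_g8: "symplectic_rank g8_bracket g8_omega = 3"
  unfolding symplectic_rank_def
proof (rule Max_eqI)
  show "finite {dim I |I. isotropic_ideal g8_bracket g8_omega I}"
    \<comment> \<open>The bound 3 also gives the finiteness on which \<open>Max\<close>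
      depends.\<close>
    by (rule finite_subset[of _ "{..3}"]) (auto dest: isotropic_ideal_dim_le)
  show "3 \<in> {dim I |I. isotropic_ideal g8_bracket g8_omega I}"
    using isotropic_ideal_g8_ZZH dim_g8_ZZH by force
qed (auto dest: isotropic_ideal_dim_le)

text \<open>A Lagrangian subspace here has dimension 4, above the bound 3 for isotropic
  ideals.\<close>

lemma no_lagrangian_ideal_g8: "\<not> lagrangian_ideal g8_bracket g8_omega L"
proof
  assume L: "lagrangian_ideal g8_bracket g8_omega L"
  then have "dim L \<le> 3"
    by (intro isotropic_ideal_dim_le)
      (simp add: lagrangian_ideal_def lagrangian_def isotropic_ideal_def)
  moreover have "2 * dim L = 8"
    using L by (simp add: lagrangian_ideal_def lagrangian_def UNIV_label)
  ultimately show False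
    by simp
qed

theorem proposition6p4:
  "symplectic_lie_algebra g8_bracket g8_omega \<and>
   four_step_nilpotent g8_bracket \<and>
   symplectic_rank g8_bracket g8_omega = 3 \<and>
   \<not> (\<exists>L. lagrangian_ideal g8_bracket g8_omega L)"
  using symplectic_lie_algebra_g8 four_step_nilpotent_g8 symplectic_rank_g8 no_lagrangian_ideal_g8
  by blast

end
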